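(* Suppose $R$ and $S$ are reduced rings where $R$ is rr-good, and $\phi\colon R\to S$ is a surjective ring homomorphism. If $s,s'\in S$ are such that $s\wedge_{\mathrm{rr}} s'=0$ and $r\in R$ satisfies $\phi(r)=s$, then there is $r'\in R$ with $\phi(r')=s'$ and $r\wedge_{\mathrm{rr}} r'=0$.
   Context: Rings are associative with $1$, not necessarily commutative; a ring is reduced if it has no nonzero nilpotent elements. On a reduced ring $R$ the rr-order is the partial order $a\le_{\mathrm{rr}} b \iff a^2=ab$. For $a,b\in R$, $a\wedge_{\mathrm{rr}} b$ denotes the infimum (greatest lower bound) of $a$ and $b$ in this order, when it exists; an equation $a\wedge_{\mathrm{rr}} b=c$ means that the infimum exists and equals $c$. A reduced ring is rr-good if every pair of its elements has an infimum in the rr-order. *)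

theory Defs
  imports "HOL-Algebra.Ring"
begin

text \<open>
  The zero ring is allowed, and is reduced. The exponent 0 is harmless below, since
  \<open>x [^] 0 = \<zero>\<close> forces the ring to be zero.
\<close>

locale reduced_ring = ring R for R (structure) +
  assumes reduced: "\<lbrakk> x \<in> carrier R; x [^] (n::nat) = \<zero> \<rbrakk> \<Longrightarrow> x = \<zero>"

definition rr_order :: "('a, 'm) ring_scheme \<Rightarrow> 'a gorder"
  where "rr_order R =
    \<lparr> carrier = carrier R, eq = (=), le = (\<lambda>a b. a \<otimes>\<^bsub>R\<^esub> a = a \<otimes>\<^bsub>R\<^esub> b) \<rparr>"

text \<open>
  The meet operation of \<open>HOL-Algebra.Lattice\<close> is a total function, so an equation about it
  would not assert that the infimum exists. The infimum is therefore a relation: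
  \<open>is_rr_inf R a b c\<close> says that the infimum of \<open>a\<close> and \<open>b\<close> exists and equals \<open>c\<close>. It
  is meaningful only for \<open>a\<close>, \<open>b\<close> in the carrier: \<open>Lower\<close> disregards other elements.
\<close>

definition is_rr_inf :: "('a, 'm) ring_scheme \<Rightarrow> 'a \<Rightarrow> 'a \<Rightarrow> 'a \<Rightarrow> bool"
  where "is_rr_inf R a b c \<longleftrightarrow> greatest (rr_order R) c (Lower (rr_order R) {a, b})"

definition rr_good :: "('a, 'm) ring_scheme \<Rightarrow> bool"
  where "rr_good R \<longleftrightarrow>
    reduced_ring R \<and> (\<forall>a\<in>carrier R. \<forall>b\<in>carrier R. \<exists>c. is_rr_inf R a b c)"

context reduced_ring
begin

lemma square_zeroD:
  assumes "x \<in> carrier R" "x \<otimes> x = \<zero>"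
  shows "x = \<zero>"
  using reduced[of x 2] assms by (simp add: numeral_2_eq_2)

lemma mult_zero_commute:
  assumes c: "x \<in> carrier R" "y \<in> carrier R" and z: "x \<otimes> y = \<zero>"
  shows "y \<otimes> x = \<zero>"
proof (rule square_zeroD)
  have "(y \<otimes> x) \<otimes> (y \<otimes> x) = y \<otimes> (x \<otimes> y) \<otimes> x"
    using c by (simp add: m_assoc)
  then show "(y \<otimes> x) \<otimes> (y \<otimes> x) = \<zero>" using c z by simp
qed (use c in simp)

lemma mult_eq_iff:
  assumes c: "a \<in> carrier R" "b \<in> carrier R" "d \<in> carrier R"
  shows "a \<otimes> b = a \<otimes> d \<longleftrightarrow> a \<otimes> (d \<ominus> b) = \<zero>"
proof -
  have e: "a \<otimes> (d \<ominus> b) = a \<otimes> d \<ominus> a \<otimes> b"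
    using c by (simp add: a_minus_def r_distr r_minus)
  have "a \<otimes> d = (a \<otimes> d \<ominus> a \<otimes> b) \<oplus> a \<otimes> b"
    using c by (simp add: a_minus_def a_assoc l_neg)
  then have "a \<otimes> b = a \<otimes> d" if "a \<otimes> d \<ominus> a \<otimes> b = \<zero>"
    using c unfolding that by simp
  moreover have "a \<otimes> d \<ominus> a \<otimes> b = \<zero>" if "a \<otimes> b = a \<otimes> d"
    using c unfolding that by (simp add: a_minus_def r_neg)
  ultimately show ?thesis unfolding e by blast
qed

theorem rr_order_partial_order: "partial_order (rr_order R)"
proof (unfold_locales, goal_cases)
  case (5 a b)
  then have c: "a \<in> carrier R" "b \<in> carrier R"
    and ab: "a \<otimes> a = a \<otimes> b" and ba: "b \<otimes> b = b \<otimes> a"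
    by (simp_all add: rr_order_def)
  have "a \<otimes> (b \<ominus> a) = \<zero>"
    using ab by (rule mult_eq_iff[THEN iffD1, OF c(1,1,2)])
  moreover have "b \<otimes> (b \<ominus> a) = \<zero>"
    using ba[symmetric] by (rule mult_eq_iff[THEN iffD1, OF c(2,1,2)])
  moreover have "(b \<ominus> a) \<otimes> (b \<ominus> a) = b \<otimes> (b \<ominus> a) \<ominus> a \<otimes> (b \<ominus> a)"
    using c minus_closed[OF c(2,1)] unfolding a_minus_def by (simp add: l_distr l_minus)
  ultimately have "(b \<ominus> a) \<otimes> (b \<ominus> a) = \<zero>"
    by (simp add: a_minus_def r_neg)
  then have "b \<ominus> a = \<zero>"
    by (rule square_zeroD[rotated]) (use c in simp)
  then have "\<one> \<otimes> a = \<one> \<otimes> b"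
    by (intro mult_eq_iff[THEN iffD2, OF one_closed c]) simp
  then show ?case using c by (simp add: rr_order_def)
next
  case (6 a b d)
  then have c: "a \<in> carrier R" "b \<in> carrier R" "d \<in> carrier R"
    and ab: "a \<otimes> a = a \<otimes> b" and bd: "b \<otimes> b = b \<otimes> d"
    by (simp_all add: rr_order_def)
  let ?x = "d \<ominus> b"
  have x: "?x \<in> carrier R" using c by simp
  have bx: "b \<otimes> ?x = \<zero>"
    using bd by (rule mult_eq_iff[THEN iffD1, OF c(2,2,3)])
  have "a \<otimes> (a \<otimes> ?x) = (a \<otimes> a) \<otimes> ?x"
    using c x by (simp only: m_assoc)
  also have "\<dots> = a \<otimes> (b \<otimes> ?x)"
    unfolding ab using c x by (simp only: m_assoc)
  finally have "a \<otimes> (a \<otimes> ?x) = \<zero>"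
    using c bx by simp
  then have ax: "(a \<otimes> ?x) \<otimes> a = \<zero>"
    by (rule mult_zero_commute[rotated 2]) (use c x in simp_all)
  have "(a \<otimes> ?x) \<otimes> (a \<otimes> ?x) = ((a \<otimes> ?x) \<otimes> a) \<otimes> ?x"
    using c x by (simp only: m_assoc m_closed)
  then have "(a \<otimes> ?x) \<otimes> (a \<otimes> ?x) = \<zero>"
    unfolding ax using x by simp
  then have "a \<otimes> ?x = \<zero>"
    by (rule square_zeroD[rotated]) (use c x in simp)
  then have "a \<otimes> b = a \<otimes> d"
    by (rule mult_eq_iff[THEN iffD2, OF c])
  then show ?case using ab by (simp add: rr_order_def)
qed (auto simp: rr_order_def)

end

end

theory Submission
  imports Defs "HOL-Algebra.RingHom"
begin

text \<open>
  Let \<open>y\<close> be any preimage of \<open>s'\<close> and let \<open>c\<close> be the infimum of \<open>r\<close> and \<open>y\<close>. Homomorphisms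
  preserve the order, so \<open>\<phi> c\<close> is a lower bound of \<open>s\<close> and \<open>s'\<close>, hence zero, and \<open>y - c\<close> is
  again a preimage of \<open>s'\<close>. Since \<open>c \<le> y\<close>, also \<open>y - c \<le> y\<close>, so a common lower bound of \<open>r\<close>
  and \<open>y - c\<close> lies below both \<open>c\<close> and \<open>y - c\<close>, whose product is zero.
\<close>

lemma is_rr_inf_iff:
  assumes "a \<in> carrier R" "b \<in> carrier R"
  shows "is_rr_inf R a b c \<longleftrightarrow>
    c \<in> carrier R \<and> c \<otimes>\<^bsub>R\<^esub> c = c \<otimes>\<^bsub>R\<^esub> a \<and> c \<otimes>\<^bsub>R\<^esub> c = c \<otimes>\<^bsub>R\<^esub> b \<and>
    (\<forall>x\<in>carrier R. x \<otimes>\<^bsub>R\<^esub> x = x \<otimes>\<^bsub>R\<^esub> a \<and> x \<otimes>\<^bsub>R\<^esub> x = x \<otimes>\<^bsub>R\<^esub> b \<longrightarrow>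
      x \<otimes>\<^bsub>R\<^esub> x = x \<otimes>\<^bsub>R\<^esub> c)"
  using assms by (auto simp: is_rr_inf_def greatest_def Lower_def rr_order_def)

context reduced_ring
begin

lemma rr_trans:
  assumes "a \<in> carrier R" "b \<in> carrier R" "d \<in> carrier R"
    and "a \<otimes> a = a \<otimes> b" "b \<otimes> b = b \<otimes> d"
  shows "a \<otimes> a = a \<otimes> d"
proof -
  interpret rr: partial_order "rr_order R" by (rule rr_order_partial_order)
  show ?thesis
    using rr.le_trans[of a b d] assms by (simp add: rr_order_def)
qed

text \<open>The half of the argument internal to one ring: subtracting the infimum from
  \<open>b\<close> leaves nothing in common with \<open>a\<close>.\<close>

lemma is_rr_inf_diff_zero:
  assumes c: "a \<in> carrier R" "b \<in> carrier R" and inf: "is_rr_inf R a b c"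
  shows "is_rr_inf R a (b \<ominus> c) \<zero>"
proof -
  have cc: "c \<in> carrier R" and cb: "c \<otimes> c = c \<otimes> b"
    and glb: "\<And>x. \<lbrakk>x \<in> carrier R; x \<otimes> x = x \<otimes> a; x \<otimes> x = x \<otimes> b\<rbrakk> \<Longrightarrow> x \<otimes> x = x \<otimes> c"
    using inf unfolding is_rr_inf_iff[OF c] by metis+
  let ?d = "b \<ominus> c"
  have d: "?d \<in> carrier R" using c cc by simp
  have "c \<otimes> ?d = \<zero>"
    using cb mult_eq_iff[OF cc cc c(2)] by simp
  \<comment> \<open>The order only gives that \<open>c\<close> annihilates \<open>?d\<close> from
    the left; reducedness swaps the factors. As \<open>c\<close> is \<open>b \<ominus> ?d\<close>,
    the swapped product says that \<open>?d\<close> lies below \<open>b\<close>.\<close>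
  then have dc: "?d \<otimes> c = \<zero>"
    by (rule mult_zero_commute[OF cc d])
  have "b \<ominus> ?d = c"
    using c cc by (simp add: a_minus_def minus_add r_neg2)
  then have db: "?d \<otimes> ?d = ?d \<otimes> b"
    using dc mult_eq_iff[OF d d c(2)] by simp
  \<comment> \<open>Since \<open>x \<otimes> \<zero> = \<zero>\<close>, this says that
    \<open>x\<close> lies below \<open>\<zero>\<close>.\<close>
  have "x \<otimes> x = \<zero>"
    if x: "x \<in> carrier R" and xa: "x \<otimes> x = x \<otimes> a" and xd: "x \<otimes> x = x \<otimes> ?d" for x
  proof -
    have xb: "x \<otimes> x = x \<otimes> b"
      by (rule rr_trans[OF x d c(2) xd db])
    have xc: "x \<otimes> x = x \<otimes> c"
      by (rule glb[OF x xa xb])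
    then have "x \<otimes> c = x \<otimes> b" using xb by simp
    then have "x \<otimes> ?d = \<zero>"
      using mult_eq_iff[OF x cc c(2)] by simp
    then show "x \<otimes> x = \<zero>" using xd by simp
  qed
  then show ?thesis
    unfolding is_rr_inf_iff[OF c(1) d] by (metis c(1) l_null r_null zero_closed d)
qed

end

theorem proposition3p2:
  fixes R :: "('a, 'm) ring_scheme" and S :: "('b, 'n) ring_scheme"
    and \<phi> :: "'a \<Rightarrow> 'b" and s s' :: 'b and r :: 'a
  assumes "reduced_ring R" and "reduced_ring S"
    and "rr_good R"
    and "\<phi> \<in> ring_hom R S" and "\<phi> ` carrier R = carrier S"
    and "s \<in> carrier S" and "s' \<in> carrier S"
    and "is_rr_inf S s s' \<zero>\<^bsub>S\<^esub>"
    and "r \<in> carrier R" and "\<phi> r = s"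
  shows "\<exists>r'\<in>carrier R. \<phi> r' = s' \<and> is_rr_inf R r r' \<zero>\<^bsub>R\<^esub>"
proof -
  interpret R: reduced_ring R by fact
  interpret S: reduced_ring S by fact
  interpret ring_hom_ring R S \<phi>
    by (rule ring_hom_ringI2) (use assms in \<open>auto simp: R.ring_axioms S.ring_axioms\<close>)
  obtain y where y: "y \<in> carrier R" "\<phi> y = s'"
    using assms(5,7) by (metis imageE)
  obtain c where inf: "is_rr_inf R r y c"
    using assms(3,9) y(1) unfolding rr_good_def by blast
  then have c: "c \<in> carrier R" "c \<otimes>\<^bsub>R\<^esub> c = c \<otimes>\<^bsub>R\<^esub> r" "c \<otimes>\<^bsub>R\<^esub> c = c \<otimes>\<^bsub>R\<^esub> y"
    unfolding is_rr_inf_iff[OF assms(9) y(1)] by metis+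
  have "\<phi> c \<otimes>\<^bsub>S\<^esub> \<phi> c = \<phi> c \<otimes>\<^bsub>S\<^esub> s" "\<phi> c \<otimes>\<^bsub>S\<^esub> \<phi> c = \<phi> c \<otimes>\<^bsub>S\<^esub> s'"
    using c y assms(9,10) by (metis hom_mult)+
  \<comment> \<open>Being below the infimum zero means having square zero, and \<open>S\<close> is
    reduced.\<close>
  then have "\<phi> c \<otimes>\<^bsub>S\<^esub> \<phi> c = \<phi> c \<otimes>\<^bsub>S\<^esub> \<zero>\<^bsub>S\<^esub>"
    using assms(6-8) c(1) by (simp add: is_rr_inf_iff)
  then have "\<phi> c = \<zero>\<^bsub>S\<^esub>"
    by (rule S.square_zeroD[rotated, OF trans]) (use c(1) in simp_all)
  then have "\<phi> (y \<ominus>\<^bsub>R\<^esub> c) = s'"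
    using c(1) y assms(7) by (simp add: a_minus_def)
  moreover have "is_rr_inf R r (y \<ominus>\<^bsub>R\<^esub> c) \<zero>\<^bsub>R\<^esub>"
    by (rule R.is_rr_inf_diff_zero[OF assms(9) y(1) inf])
  ultimately show ?thesis
    using c(1) y(1) by blast
qed

end
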